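(* Let $n\in\mathbb{N}$, $n>1$, and let $f\in\mathcal{A}$, $g\in\mathcal{M}$, $h\in\mathcal{I}$. For $x,y\in\mathbb{Z}$ define $d^{(n)}_{(f,+)}(x,y)=d^{(n)}_{(g,+)}(x,y)=d^{(n)}_{(h,+)}(x,y)=0$ if $x=y$, and, if $x\neq y$, $$d^{(n)}_{(f,+)}(x,y)=f(\gcd(x,n))+f(\gcd(y,n)),$$ $$d^{(n)}_{(g,+)}(x,y)=g(\gcd(x,n))+g(\gcd(y,n))-2,$$ $$d^{(n)}_{(h,+)}(x,y)=2-h(\gcd(x,n))-h(\gcd(y,n)).$$ Then $d^{(n)}_{(f,+)}$, $d^{(n)}_{(g,+)}$ and $d^{(n)}_{(h,+)}$ are pseudometrics on $\mathbb{Z}$, and so also on $D_n$. If $f\in\mathcal{A}_0$, $g\in\mathcal{M}_1$ and $h\in\mathcal{I}_1$, then they are metrics on $D_n$.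
   Context: $\mathbb{N}$ is the set of positive integers and $D_n=\{x\in\mathbb{N}: x\mid n\}$. A function $f:\mathbb{N}\to\mathbb{R}$ is additive if $f(xy)=f(x)+f(y)$ for all coprime $x,y$; $g:\mathbb{N}\to\mathbb{R}$ is multiplicative if $g$ is not identically zero and $g(xy)=g(x)g(y)$ for all coprime $x,y$. In the following sets the inequalities are required for all $x\in\mathbb{N}$, $x>1$: $\mathcal{A}=\{f\text{ additive}: f(x)\ge0\}$, $\mathcal{A}_0=\{f\in\mathcal{A}: f(x)>0\}$; $\mathcal{M}=\{g\text{ multiplicative}: g(x)\ge1\}$, $\mathcal{M}_1=\{g\in\mathcal{M}: g(x)>1\}$; $\mathcal{I}=\{h\text{ multiplicative}: 0\le h(x)\le1\}$, $\mathcal{I}_1=\{h\in\mathcal{I}: 0\le h(x)<1\}$. A pseudometric on $S$ is a function $d:S\times S\to\mathbb{R}$ with $d(x,x)=0$, $d(x,y)=d(y,x)$ and $d(x,z)\le d(x,y)+d(y,z)$; it is a metric if moreover $d(x,y)=0\Rightarrow x=y$. *)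

theory Defs
  imports "HOL-Analysis.Analysis"
begin

text \<open>
  Arithmetic functions on the positive integers are rendered as functions on \<^typ>\<open>nat\<close>;
  every condition is restricted to positive arguments, so the value at 0 is irrelevant.
\<close>

definition additive_arith :: "(nat \<Rightarrow> real) \<Rightarrow> bool" where
  "additive_arith f \<longleftrightarrow>
     (\<forall>x y. x > 0 \<longrightarrow> y > 0 \<longrightarrow> coprime x y \<longrightarrow> f (x * y) = f x + f y)"

definition multiplicative_arith :: "(nat \<Rightarrow> real) \<Rightarrow> bool" where
  "multiplicative_arith g \<longleftrightarrow>
     (\<exists>x>0. g x \<noteq> 0) \<and>
     (\<forall>x y. x > 0 \<longrightarrow> y > 0 \<longrightarrow> coprime x y \<longrightarrow> g (x * y) = g x * g y)"

definition class_A :: "(nat \<Rightarrow> real) set" where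
  "class_A = {f. additive_arith f \<and> (\<forall>x>1. f x \<ge> 0)}"

definition class_A0 :: "(nat \<Rightarrow> real) set" where
  "class_A0 = {f \<in> class_A. \<forall>x>1. f x > 0}"

definition class_M :: "(nat \<Rightarrow> real) set" where
  "class_M = {g. multiplicative_arith g \<and> (\<forall>x>1. g x \<ge> 1)}"

definition class_M1 :: "(nat \<Rightarrow> real) set" where
  "class_M1 = {g \<in> class_M. \<forall>x>1. g x > 1}"

definition class_I :: "(nat \<Rightarrow> real) set" where
  "class_I = {h. multiplicative_arith h \<and> (\<forall>x>1. 0 \<le> h x \<and> h x \<le> 1)}"

definition class_I1 :: "(nat \<Rightarrow> real) set" where
  "class_I1 = {h \<in> class_I. \<forall>x>1. 0 \<le> h x \<and> h x < 1}"

definition divisor_set :: "nat \<Rightarrow> nat set" where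
  "divisor_set n = {x. x > 0 \<and> x dvd n}"

definition pseudometric_on :: "'a set \<Rightarrow> ('a \<Rightarrow> 'a \<Rightarrow> real) \<Rightarrow> bool" where
  "pseudometric_on S d \<longleftrightarrow>
     (\<forall>x\<in>S. d x x = 0) \<and>
     (\<forall>x\<in>S. \<forall>y\<in>S. d x y = d y x) \<and>
     (\<forall>x\<in>S. \<forall>y\<in>S. \<forall>z\<in>S. d x z \<le> d x y + d y z)"

definition metric_on :: "'a set \<Rightarrow> ('a \<Rightarrow> 'a \<Rightarrow> real) \<Rightarrow> bool" where
  "metric_on S d \<longleftrightarrow> pseudometric_on S d \<and> (\<forall>x\<in>S. \<forall>y\<in>S. d x y = 0 \<longrightarrow> x = y)"

text \<open>
  The locale \<^locale>\<open>Metric_space\<close> has no pseudometric counterpart, and it demands symmetry and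
  nonnegativity on the whole type; up to values outside the carrier, the notions agree.
\<close>

lemma metric_on_iff_Metric_space:
  "metric_on S d \<longleftrightarrow> Metric_space S (\<lambda>x y. if x \<in> S \<and> y \<in> S then d x y else 0)"
proof
  assume m: "metric_on S d"
  have "d x y \<ge> 0" if "x \<in> S" "y \<in> S" for x y
  proof -
    have "d x x \<le> d x y + d y x" "d x x = 0" "d x y = d y x"
      using m that unfolding metric_on_def pseudometric_on_def by blast+
    then show ?thesis by linarith
  qed
  with m show "Metric_space S (\<lambda>x y. if x \<in> S \<and> y \<in> S then d x y else 0)"
    unfolding metric_on_def pseudometric_on_def Metric_space_def by auto
next
  assume "Metric_space S (\<lambda>x y. if x \<in> S \<and> y \<in> S then d x y else 0)"
  then interpret Metric_space S "\<lambda>x y. if x \<in> S \<and> y \<in> S then d x y else 0" .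
  have "d x x = 0" if "x \<in> S" for x
    using zero[of x x] that by simp
  moreover have "d x y = d y x" if "x \<in> S" "y \<in> S" for x y
    using commute[of x y] that by simp
  moreover have "d x z \<le> d x y + d y z" if "x \<in> S" "y \<in> S" "z \<in> S" for x y z
    using triangle[of x y z] that by simp
  moreover have "x = y" if "x \<in> S" "y \<in> S" "d x y = 0" for x y
    using zero[of x y] that by simp
  ultimately show "metric_on S d"
    unfolding metric_on_def pseudometric_on_def by blast
qed

definition gcdn :: "nat \<Rightarrow> int \<Rightarrow> nat" where
  "gcdn n x = nat (gcd x (int n))"

definition dist_f_plus :: "nat \<Rightarrow> (nat \<Rightarrow> real) \<Rightarrow> int \<Rightarrow> int \<Rightarrow> real" where
  "dist_f_plus n f x y = (if x = y then 0 else f (gcdn n x) + f (gcdn n y))"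

definition dist_g_plus :: "nat \<Rightarrow> (nat \<Rightarrow> real) \<Rightarrow> int \<Rightarrow> int \<Rightarrow> real" where
  "dist_g_plus n g x y = (if x = y then 0 else g (gcdn n x) + g (gcdn n y) - 2)"

definition dist_h_plus :: "nat \<Rightarrow> (nat \<Rightarrow> real) \<Rightarrow> int \<Rightarrow> int \<Rightarrow> real" where
  "dist_h_plus n h x y = (if x = y then 0 else 2 - h (gcdn n x) - h (gcdn n y))"

end

theory Submission
  imports Defs
begin

text \<open>
  Each of the three distances has the form \<open>d x y = w x + w y\<close> for \<open>x \<noteq> y\<close>, with a weight
  \<open>w \<ge> 0\<close> that factors through the gcd with \<open>n\<close>; nonnegativity alone gives the triangle
  inequality. The values of arithmetic functions at 1 are forced, so that the weight vanishes there,
  and two distinct divisors of \<open>n\<close> cannot both be 1, so a weight positive beyond 1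
  separates them.
\<close>

text \<open>This is the path length in a star graph: each point hangs from a common hub by an edge
  of length \<open>w x\<close>, and distinct points are joined through the hub.\<close>

definition star_dist :: "('a \<Rightarrow> real) \<Rightarrow> 'a \<Rightarrow> 'a \<Rightarrow> real" where
  "star_dist w x y = (if x = y then 0 else w x + w y)"

text \<open>For distinct \<open>x\<close>, \<open>y\<close>, \<open>z\<close> the detour through
  \<open>y\<close> costs an extra \<open>2 * w y\<close>. If \<open>x = z\<close>, only
  nonnegativity of the right side is at stake.\<close>

lemma pseudometric_on_star_dist:
  assumes "\<And>x. x \<in> S \<Longrightarrow> w x \<ge> 0"
  shows "pseudometric_on S (star_dist w)"
  using assms unfolding pseudometric_on_def star_dist_def by force

text \<open>Distance zero between distinct points would make both nonnegative weights vanish;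
  \<open>pos\<close> allows at most one point of weight zero.\<close>

lemma metric_on_star_dist:
  assumes nonneg: "\<And>x. x \<in> S \<Longrightarrow> w x \<ge> 0"
    and pos: "\<And>x y. x \<in> S \<Longrightarrow> y \<in> S \<Longrightarrow> x \<noteq> y \<Longrightarrow> w x > 0 \<or> w y > 0"
  shows "metric_on S (star_dist w)"
  unfolding metric_on_def
proof (intro conjI ballI impI)
  show "pseudometric_on S (star_dist w)"
    using nonneg by (rule pseudometric_on_star_dist)
next
  fix x y assume "x \<in> S" "y \<in> S" "star_dist w x y = 0"
  then show "x = y"
    using pos[of x y] nonneg[of x] nonneg[of y]
    by (cases "x = y") (simp_all add: star_dist_def add_nonneg_eq_0_iff)
qed

lemma additive_arith_1: "additive_arith f \<Longrightarrow> f 1 = 0"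
  \<comment> \<open>The coprime pair 1, 1 gives \<open>f 1 = f 1 + f 1\<close>.\<close>
  unfolding additive_arith_def by (drule spec[of _ 1], drule spec[of _ 1]) simp

lemma multiplicative_arith_1:
  assumes "multiplicative_arith g"
  shows "g 1 = 1"
proof -
  obtain x where "x > 0" "g x \<noteq> 0"
    using assms unfolding multiplicative_arith_def by blast
  \<comment> \<open>Pairing 1 with a point where \<open>g\<close> is nonzero lets \<open>g x\<close>
    be cancelled; the pair 1, 1 alone would leave \<open>g 1 = 0\<close> possible.\<close>
  moreover from this have "g (x * 1) = g x * g 1"
    using assms unfolding multiplicative_arith_def by (metis coprime_1_right zero_less_one)
  ultimately show ?thesis by simp
qed

lemma gcdn_pos: "n > 0 \<Longrightarrow> gcdn n x > 0"
  by (simp add: gcdn_def)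

text \<open>This is what separates points of the divisor set. Among all integers, any two coprime to
  \<open>n\<close> share the gcd 1, hence weight zero, and lie at distance 0.\<close>

lemma gcdn_divisor: "x \<in> divisor_set n \<Longrightarrow> gcdn n (int x) = x"
  by (simp add: gcdn_def divisor_set_def gcd_nat.absorb1)

text \<open>The gcd with \<open>n > 0\<close> is at least 1, so the assumptions on \<open>w\<close>
  cover every value that occurs. As \<open>S\<close> is arbitrary, this serves both the integers and
  the divisors.\<close>

lemma pseudometric_on_gcd_star_dist:
  assumes "n > 0" and "w 1 = 0" and "\<forall>x>1. w x \<ge> 0"
  shows "pseudometric_on S (star_dist (\<lambda>x. w (gcdn n x)))"
proof (rule pseudometric_on_star_dist)
  fix x
  show "w (gcdn n x) \<ge> 0"
    using assms gcdn_pos[of n x] by (cases "gcdn n x = 1") auto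
qed

lemma metric_on_gcd_star_dist:
  assumes "w 1 = 0" and "\<forall>x>1. w x > 0"
  shows "metric_on (int ` divisor_set n) (star_dist (\<lambda>x. w (gcdn n x)))"
proof (rule metric_on_star_dist)
  have "w x \<ge> 0" if "x > 0" for x
    using that assms by (cases "x = 1") (auto intro: less_imp_le)
  then show "w (gcdn n x) \<ge> 0" if "x \<in> int ` divisor_set n" for x
    using that by (auto simp: gcdn_divisor) (simp add: divisor_set_def)
next
  fix x y assume "x \<in> int ` divisor_set n" "y \<in> int ` divisor_set n" "x \<noteq> y"
  then obtain a b where ab: "x = int a" "y = int b" "a \<in> divisor_set n" "b \<in> divisor_set n" "a \<noteq> b"
    by auto
  then have "a > 1 \<or> b > 1"
    by (auto simp: divisor_set_def)
  then show "w (gcdn n x) > 0 \<or> w (gcdn n y) > 0"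
    using ab assms(2) by (auto simp: gcdn_divisor)
qed

lemma dist_f_plus_eq: "dist_f_plus n f = star_dist (\<lambda>x. f (gcdn n x))"
  by (simp add: fun_eq_iff dist_f_plus_def star_dist_def)

text \<open>The constant 2 is shared out as 1 per point, giving the weight \<open>g m - 1\<close>
  here and \<open>1 - h m\<close> below; the applied abstraction displays the shape
  \<open>w (gcdn n x)\<close>.\<close>

lemma dist_g_plus_eq: "dist_g_plus n g = star_dist (\<lambda>x. (\<lambda>m. g m - 1) (gcdn n x))"
  by (simp add: fun_eq_iff dist_g_plus_def star_dist_def)

lemma dist_h_plus_eq: "dist_h_plus n h = star_dist (\<lambda>x. (\<lambda>m. 1 - h m) (gcdn n x))"
  by (simp add: fun_eq_iff dist_h_plus_def star_dist_def)

theorem theorem3p6: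
  fixes n :: nat and f g h :: "nat \<Rightarrow> real"
  assumes "n > 1" and "f \<in> class_A" and "g \<in> class_M" and "h \<in> class_I"
  shows "pseudometric_on (UNIV :: int set) (dist_f_plus n f)
       \<and> pseudometric_on (UNIV :: int set) (dist_g_plus n g)
       \<and> pseudometric_on (UNIV :: int set) (dist_h_plus n h)
       \<and> pseudometric_on (int ` divisor_set n) (dist_f_plus n f)
       \<and> pseudometric_on (int ` divisor_set n) (dist_g_plus n g)
       \<and> pseudometric_on (int ` divisor_set n) (dist_h_plus n h)
       \<and> (f \<in> class_A0 \<longrightarrow> metric_on (int ` divisor_set n) (dist_f_plus n f))
       \<and> (g \<in> class_M1 \<longrightarrow> metric_on (int ` divisor_set n) (dist_g_plus n g))
       \<and> (h \<in> class_I1 \<longrightarrow> metric_on (int ` divisor_set n) (dist_h_plus n h))"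
proof -
  have f1: "f 1 = 0" and g1: "g 1 - 1 = 0" and h1: "1 - h 1 = 0"
    using assms additive_arith_1[of f] multiplicative_arith_1[of g] multiplicative_arith_1[of h]
    by (simp_all add: class_A_def class_M_def class_I_def)
  have n: "n > 0"
    using assms(1) by simp
  have "pseudometric_on S (dist_f_plus n f)" for S
    unfolding dist_f_plus_eq using assms(2)
    by (intro pseudometric_on_gcd_star_dist[where w = f, OF n f1]) (simp add: class_A_def)
  moreover have "pseudometric_on S (dist_g_plus n g)" for S
    unfolding dist_g_plus_eq using assms(3)
    by (intro pseudometric_on_gcd_star_dist[where w = "\<lambda>m. g m - 1", OF n g1])
      (simp add: class_M_def)
  moreover have "pseudometric_on S (dist_h_plus n h)" for S
    unfolding dist_h_plus_eq using assms(4)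
    by (intro pseudometric_on_gcd_star_dist[where w = "\<lambda>m. 1 - h m", OF n h1])
      (simp add: class_I_def)
  moreover have "metric_on (int ` divisor_set n) (dist_f_plus n f)" if "f \<in> class_A0"
    unfolding dist_f_plus_eq using that
    by (intro metric_on_gcd_star_dist[where w = f, OF f1]) (simp add: class_A0_def)
  moreover have "metric_on (int ` divisor_set n) (dist_g_plus n g)" if "g \<in> class_M1"
    unfolding dist_g_plus_eq using that
    by (intro metric_on_gcd_star_dist[where w = "\<lambda>m. g m - 1", OF g1]) (simp add: class_M1_def)
  moreover have "metric_on (int ` divisor_set n) (dist_h_plus n h)" if "h \<in> class_I1"
    unfolding dist_h_plus_eq using that
    by (intro metric_on_gcd_star_dist[where w = "\<lambda>m. 1 - h m", OF h1]) (simp add: class_I1_def)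
  ultimately show ?thesis by blast
qed

end
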